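(* Let $pds_{3D}(n)$ be the number of (non-oriented) $3D$ partially directed snakes of length $n$. Then, as formal power series, $$\sum_{n\ge 0} pds_{3D}(n)\,q^n=\frac{4q^5+2q^4+2q^2-3q+1}{(1-q)(1-3q-4q^3)}.$$ Moreover $pds_{3D}(0)=pds_{3D}(1)=1$ and for all $n\ge 2$ $$pds_{3D}(n)=\frac{1}{12}\sum_{\alpha:\,1-3\alpha-4\alpha^3=0}\left(\alpha^{-1}+1\right)\alpha^{-n}\;-\;1,$$ where the sum runs over the complex roots $\alpha$ of $1-3\alpha-4\alpha^3$.
   Context: Cells are the unit cubes of the lattice $\mathbb{Z}^3$ (axes $x,y,z$); two cells are adjacent if they share a face. A $3D$ polyomino is a finite face-connected set of cells, considered up to translation, viewed as a graph via face adjacency. A $3D$ snake of length $n$ is a $3D$ polyomino with $n$ cells, no cycle, and every cell of degree at most two (so its adjacency graph is a path). Snakes are non-oriented, i.e. counted as sets of cells up to translation (no rotations or reflections). A $3D$ snake is a $3D$ partially directed snake ($3D$ PDS) if its cells can be listed from one end of the path to the other so that each step is in one of the four directions $x^+,x^-,y^+,z^+$ (steps in the negative $y$ and $z$ directions are forbidden). By convention the empty snake is the unique $3D$ PDS of length $0$. *)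

theory Defs
  imports Complex_Main "HOL-Library.Product_Plus"
    "HOL-Computational_Algebra.Formal_Power_Series"
begin

text \<open>A unit cube of the lattice is represented by its integer coordinates
  \<open>(x, y, z)\<close>; sharing a face means differing by one in exactly one coordinate.\<close>

type_synonym cell = "int \<times> int \<times> int"

definition adjacent :: "cell \<Rightarrow> cell \<Rightarrow> bool" where
  "adjacent a b \<longleftrightarrow>
     b - a \<in> {(1,0,0), (-1,0,0), (0,1,0), (0,-1,0), (0,0,1), (0,0,-1)}"

definition face_connected :: "cell set \<Rightarrow> bool" where
  "face_connected S \<longleftrightarrow>
     (\<forall>a\<in>S. \<forall>b\<in>S. (a, b) \<in> {(c, d). c \<in> S \<and> d \<in> S \<and> adjacent c d}\<^sup>*)"

text \<open>Polyominoes are represented by concrete sets of cells; translation is factored out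
  only when counting. The empty set is admitted, for the empty snake.\<close>

definition polyomino3D :: "cell set \<Rightarrow> bool" where
  "polyomino3D S \<longleftrightarrow> finite S \<and> face_connected S"

definition degree_in :: "cell set \<Rightarrow> cell \<Rightarrow> nat" where
  "degree_in S c = card {d \<in> S. adjacent c d}"

definition is_cycle :: "cell set \<Rightarrow> cell list \<Rightarrow> bool" where
  "is_cycle S cs \<longleftrightarrow> length cs \<ge> 3 \<and> distinct cs \<and> set cs \<subseteq> S \<and>
     successively adjacent cs \<and> adjacent (last cs) (hd cs)"

definition snake3D :: "cell set \<Rightarrow> bool" where
  "snake3D S \<longleftrightarrow> polyomino3D S \<and> (\<nexists>cs. is_cycle S cs) \<and> (\<forall>c\<in>S. degree_in S c \<le> 2)"

definition pd_step :: "cell \<Rightarrow> cell \<Rightarrow> bool" where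
  "pd_step a b \<longleftrightarrow> b - a \<in> {(1,0,0), (-1,0,0), (0,1,0), (0,0,1)}"

text \<open>Every \<open>pd_step\<close> is an adjacency, so a repetition-free list of all cells of a snake whose
  consecutive cells are related by \<open>pd_step\<close> runs along the path from one end to the other.\<close>

definition pds3D_set :: "cell set \<Rightarrow> bool" where
  "pds3D_set S \<longleftrightarrow> snake3D S \<and>
     (\<exists>cs. distinct cs \<and> set cs = S \<and> successively pd_step cs)"

definition translation_rel :: "(cell set \<times> cell set) set" where
  "translation_rel = {(A, B). \<exists>t. B = (\<lambda>c. c + t) ` A}"

definition pds3D :: "nat \<Rightarrow> nat" where
  "pds3D n = card ({S. pds3D_set S \<and> card S = n} // translation_rel)"

end

(* Listing a snake along its directed steps turns it into a word over the four directions. The cells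
   of such a walk form an induced path exactly when no letter is opposite to one of the next two
   letters (patterns x+ x-, x+ y+ x-, x+ z+ x- and their mirror images): if two cells differ by height
   at most 1, the horizontal steps between them all have the same sign, so the displacement has
   l1-norm equal to the number of steps. A set of cells determines its word up to reversal, and the
   reversed word is again directed only for the two words of purely horizontal steps, which give the
   same snake. Hence pds(n) + 1 is the number of admissible words of length n - 1; a transfer
   recursion gives N(m+3) = 3 N(m+2) + 4 N(m), whose characteristic roots are the inverses of the
   roots of 1 - 3 t - 4 t^3. *)

theory Submission
  imports Defs "HOL-Computational_Algebra.Fundamental_Theorem_Algebra"
begin

section \<open>Directed steps, admissible words and their walks\<close>

definition dirs :: "cell set" where
  "dirs = {(1,0,0), (-1,0,0), (0,1,0), (0,0,1)}"

text \<open>A horizontal direction has height 0 and the other two have height 1, so the height of a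
  displacement counts the non-horizontal steps of a directed walk.\<close>

definition height :: "cell \<Rightarrow> int" where
  "height d = fst (snd d) + snd (snd d)"

text \<open>The two tests exclude an immediate return and a U-turn, which would close a unit square.
  On words over \<open>dirs\<close> they can fail only for horizontal \<open>a\<close>, since the
  opposite of an upward letter is not a direction. The disjunct \<open>w = []\<close> guards the
  \<open>hd\<close>.\<close>

fun admissible :: "cell list \<Rightarrow> bool" where
  "admissible (a # b # w) \<longleftrightarrow> b \<noteq> - a \<and> (w = [] \<or> hd w \<noteq> - a) \<and> admissible (b # w)"
| "admissible _ \<longleftrightarrow> True"

fun walk :: "cell \<Rightarrow> cell list \<Rightarrow> cell list" where
  "walk c [] = [c]"
| "walk c (d # w) = c # walk (c + d) w"

lemma pd_step_iff: "pd_step a b \<longleftrightarrow> b - a \<in> dirs"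
  by (simp add: pd_step_def dirs_def)

lemma adjacent_iff: "adjacent a b \<longleftrightarrow> b - a \<in> dirs \<or> a - b \<in> dirs"
  by (cases a; cases b) (auto simp: adjacent_def dirs_def)

lemma adjacent_sym: "adjacent a b \<Longrightarrow> adjacent b a"
  by (auto simp: adjacent_iff)

lemma pd_step_adjacent: "pd_step a b \<Longrightarrow> adjacent a b"
  by (simp add: pd_step_iff adjacent_iff)

lemma not_adjacent_refl: "\<not> adjacent a a"
  by (simp add: adjacent_def zero_prod_def)

section \<open>Words and walks\<close>

lemma admissible_Cons: "admissible (a # w) \<Longrightarrow> admissible w"
  by (cases w) auto

text \<open>The tests concern windows of at most three consecutive letters, and a window of a factor
  is a window of the whole word.\<close>

lemma admissible_append: "admissible (u @ v) \<Longrightarrow> admissible u \<and> admissible v"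
proof (induction u rule: admissible.induct)
  case (1 a b w)
  then show ?case by (cases w) auto
next
  case ("2_2" a)
  then show ?case using admissible_Cons by auto
qed auto

lemma admissible_take_drop: "admissible w \<Longrightarrow> admissible (take k (drop i w))"
  by (metis admissible_append append_take_drop_id)

lemma horizontal_dirs_eq:
  "\<lbrakk>a \<in> dirs; b \<in> dirs; fst a \<noteq> 0; fst b \<noteq> 0; b \<noteq> - a\<rbrakk> \<Longrightarrow> b = a"
  by (auto simp: dirs_def)

text \<open>With at most one upward letter, consecutive horizontal letters are at most two positions
  apart, and admissibility forces them to be equal.\<close>

lemma admissible_sign:
  assumes "admissible w" "set w \<subseteq> dirs" "(\<Sum>d\<leftarrow>w. height d) \<le> 1"
  shows "(\<forall>d\<in>set w. 0 \<le> fst d) \<or> (\<forall>d\<in>set w. fst d \<le> 0)"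
  using assms
proof (induction w)
  case (Cons a w)
  have nonneg: "0 \<le> height d" "fst d = 0 \<Longrightarrow> height d = 1" if "d \<in> dirs" for d
    using that by (auto simp: dirs_def height_def)
  have a: "a \<in> dirs" using Cons.prems by auto
  have IH: "(\<forall>d\<in>set w. 0 \<le> fst d) \<or> (\<forall>d\<in>set w. fst d \<le> 0)"
    using Cons nonneg(1)[OF a] admissible_Cons by auto
  show ?case
  proof (cases "fst a = 0 \<or> w = [] \<or> a \<in> set w")
    case True
    then show ?thesis using IH by auto
  next
    case False
    \<comment> \<open>Here \<open>a\<close> is horizontal and does not recur. The next letter must
      then be upward, which exhausts the height; a third letter would be horizontal and hence equal
      to \<open>a\<close>.\<close>
    then obtain b v where w: "w = b # v" by (cases w) auto
    have b: "fst b = 0" "height b = 1"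
      using False Cons.prems horizontal_dirs_eq[of a b] nonneg(2)[of b] unfolding w by auto
    have "v = []"
    proof (rule ccontr)
      assume "v \<noteq> []"
      then obtain c u where v: "v = c # u" by (cases v) auto
      have "0 \<le> (\<Sum>d\<leftarrow>u. height d)"
        using Cons.prems nonneg(1) unfolding w v by (intro sum_list_nonneg) auto
      then have "fst c \<noteq> 0"
        using Cons.prems b(2) nonneg[of c] nonneg(1)[OF a] unfolding w v by auto
      then show False
        using False Cons.prems horizontal_dirs_eq[of a c] unfolding w v by auto
    qed
    then show ?thesis using b unfolding w by auto
  qed
qed simp

lemma sum_list_fst: "fst (sum_list (w :: cell list)) = (\<Sum>d\<leftarrow>w. fst d)"
  by (induction w) auto

lemma sum_list_height: "height (sum_list w) = (\<Sum>d\<leftarrow>w. height d)"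
  by (induction w) (auto simp: height_def)

text \<open>Without sign changes nothing cancels: every letter adds exactly one to the sum of
  absolute x-displacement and height.\<close>

lemma abs_fst_add_height:
  assumes "set w \<subseteq> dirs" "(\<forall>d\<in>set w. 0 \<le> fst d) \<or> (\<forall>d\<in>set w. fst d \<le> 0)"
  shows "\<bar>\<Sum>d\<leftarrow>w. fst d\<bar> + (\<Sum>d\<leftarrow>w. height d) = int (length w)"
proof -
  have "(\<Sum>d\<leftarrow>w. fst d) + (\<Sum>d\<leftarrow>w. height d) = int (length w) \<and> 0 \<le> (\<Sum>d\<leftarrow>w. fst d)"
    if "\<forall>d\<in>set w. 0 \<le> fst d"
    using assms(1) that by (induction w) (auto simp: dirs_def height_def)
  moreover have "- (\<Sum>d\<leftarrow>w. fst d) + (\<Sum>d\<leftarrow>w. height d) = int (length w) \<and> (\<Sum>d\<leftarrow>w. fst d) \<le> 0"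
    if "\<forall>d\<in>set w. fst d \<le> 0"
    using assms(1) that by (induction w) (auto simp: dirs_def height_def)
  ultimately show ?thesis using assms(2) by linarith
qed

text \<open>The absolute x-displacement plus the height is at least 2: either the height alone is,
  or the horizontal letters have one sign and the sum is the length. For zero and for unit vectors
  this quantity is at most 1.\<close>

lemma admissible_sum_far:
  assumes "admissible w" "set w \<subseteq> dirs" "2 \<le> length w"
  shows "sum_list w \<noteq> 0" "\<not> adjacent a (a + sum_list w)"
proof -
  have h: "0 \<le> height (sum_list w)" unfolding sum_list_height
    using assms by (intro sum_list_nonneg) (auto simp: dirs_def height_def)
  have "2 \<le> \<bar>fst (sum_list w)\<bar> + height (sum_list w)"
  proof (cases "height (sum_list w) \<le> 1")
    case True
    then show ?thesis
      using admissible_sign[OF assms(1,2)] abs_fst_add_height[OF assms(2)] assms(3)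
      by (simp add: sum_list_fst sum_list_height)
  qed auto
  then show "sum_list w \<noteq> 0" "\<not> adjacent a (a + sum_list w)"
    by (auto simp: adjacent_def height_def zero_prod_def)
qed

lemma length_walk [simp]: "length (walk c w) = Suc (length w)"
  by (induction w arbitrary: c) auto

lemma walk_nth: "i \<le> length w \<Longrightarrow> walk c w ! i = c + sum_list (take i w)"
  by (induction w arbitrary: c i) (auto simp: nth_Cons take_Cons split: nat.splits)

lemma hd_walk [simp]: "hd (walk c w) = c"
  by (cases w) auto

lemma walk_neq_Nil [simp]: "walk c w \<noteq> []"
  by (cases w) auto

lemma map_walk: "map (\<lambda>x. x + t) (walk c w) = walk (c + t) w"
  by (induction w arbitrary: c) (auto simp: algebra_simps)

lemma walk_inj: "walk c w = walk c' w' \<longleftrightarrow> c = c' \<and> w = w'"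
proof (induction w arbitrary: c c' w')
  case Nil
  then show ?case by (cases w') (auto simp: neq_commute[of "[]"] eq_commute[of "[]"])
next
  case (Cons d w)
  then show ?case by (cases w') auto
qed

lemma successively_walk: "successively pd_step (walk c w) \<longleftrightarrow> set w \<subseteq> dirs"
  by (induction w arbitrary: c) (auto simp: successively_Cons pd_step_iff)

text \<open>The letters are the successive differences, arbitrary vectors at this point;
  \<open>successively_walk\<close> decides whether they lie in \<open>dirs\<close>.\<close>

lemma walk_of_steps:
  assumes "cs \<noteq> []"
  obtains w where "cs = walk (hd cs) w"
proof -
  have "\<exists>w. cs = walk (hd cs) w"
    using assms
  proof (induction cs rule: induct_list012)
    case (2 x)
    have "[x] = walk x []" by simp
    then show ?case by (metis list.sel(1))
  next
    case (3 x y zs)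
    then obtain w where "y # zs = walk y w" by auto
    then have "x # y # zs = walk x ((y - x) # w)" by simp
    then show ?case by (metis list.sel(1))
  qed simp
  then show ?thesis using that by blast
qed

lemma walk_nth_diff:
  assumes "i \<le> j" "j \<le> length w"
  shows "walk c w ! j = walk c w ! i + sum_list (take (j - i) (drop i w))"
proof -
  have "take j w = take i w @ take (j - i) (drop i w)"
    using assms by (metis le_add_diff_inverse take_add)
  then show ?thesis using assms by (simp add: walk_nth add.assoc)
qed

text \<open>The displacement from position \<open>i\<close> to \<open>j\<close> is the sum of the
  factor of \<open>w\<close> between them, which is again admissible. Factors of length at least two
  fall under \<open>admissible_sum_far\<close>; a single letter is nonzero.\<close>

lemma admissible_walk_nth:
  assumes "admissible w" "set w \<subseteq> dirs" "i < j" "j \<le> length w"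
  shows "walk c w ! i \<noteq> walk c w ! j"
    and "adjacent (walk c w ! i) (walk c w ! j) \<Longrightarrow> j = Suc i"
proof -
  let ?u = "take (j - i) (drop i w)"
  have eq: "walk c w ! j = walk c w ! i + sum_list ?u"
    using assms by (intro walk_nth_diff) auto
  have u: "admissible ?u" "set ?u \<subseteq> dirs" "length ?u = j - i"
    using assms admissible_take_drop[OF assms(1)]
    by (auto dest!: in_set_takeD in_set_dropD simp del: split_paired_All)
  show "adjacent (walk c w ! i) (walk c w ! j) \<Longrightarrow> j = Suc i"
    using admissible_sum_far(2)[OF u(1,2), of "walk c w ! i"] u(3) assms(3) unfolding eq
    by fastforce
  show "walk c w ! i \<noteq> walk c w ! j"
  proof (cases "j = Suc i")
    case True
    then have "?u = [w ! i]" using assms by (simp add: take_Suc hd_drop_conv_nth)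
    moreover have "w ! i \<in> dirs" using assms True by auto
    ultimately show ?thesis unfolding eq by (auto simp: dirs_def zero_prod_def)
  next
    case False
    then show ?thesis using admissible_sum_far(1)[OF u(1,2)] u(3) assms(3,4) unfolding eq by auto
  qed
qed

lemma distinct_walk:
  assumes "admissible w" "set w \<subseteq> dirs"
  shows "distinct (walk c w)"
  unfolding distinct_conv_nth
  using admissible_walk_nth(1)[OF assms] by (metis length_walk less_Suc_eq_le linorder_neqE_nat)

lemma walk_adjacent_nth:
  assumes "admissible w" "set w \<subseteq> dirs" "i \<le> length w" "j \<le> length w"
    "adjacent (walk c w ! i) (walk c w ! j)"
  shows "\<bar>int j - int i\<bar> = 1"
proof -
  consider "i < j" | "j < i" using assms(5) not_adjacent_refl by (metis linorder_neqE_nat)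
  then show ?thesis
    using admissible_walk_nth(2)[OF assms(1,2), of i j c] admissible_walk_nth(2)[OF assms(1,2), of j i c]
      assms(3-5) adjacent_sym by cases auto
qed


section \<open>Snakes as induced walks\<close>

text \<open>A self-avoiding path of integers with steps \<open>\<plusminus>1\<close> never turns around.\<close>

lemma unit_steps_arith:
  fixes a b d :: int
  assumes "distinct (a # b # ns)" "successively (\<lambda>i j. \<bar>j - i\<bar> = 1) (a # b # ns)" "b = a + d"
    "k < length (a # b # ns)"
  shows "(a # b # ns) ! k = a + d * int k"
  using assms
proof (induction ns arbitrary: a b k)
  case Nil
  then show ?case by (auto simp: less_Suc_eq)
next
  case (Cons c ns)
  have "c = b + d" using Cons.prems by auto
  then show ?case
    using Cons.IH[of b c "k - 1"] Cons.prems
    by (cases k) (auto simp: algebra_simps)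
qed

text \<open>Adjacent cells of an admissible walk have neighbouring indices, so a path without
  repetition inside the walk reads off indices in arithmetic progression with difference 1 or -1.
  This serves both to exclude cycles and to compare two walks on the same cells.\<close>

lemma walk_indices:
  assumes "admissible w" "set w \<subseteq> dirs" "distinct cs" "set cs \<subseteq> set (walk c w)"
    "successively adjacent cs"
  obtains ks a d where "cs = map (\<lambda>k. walk c w ! k) ks" "set ks \<subseteq> {..length w}" "distinct ks"
    "\<bar>d\<bar> = 1" "\<And>i. i < length ks \<Longrightarrow> int (ks ! i) = a + d * int i"
proof -
  have "\<forall>x\<in>set cs. \<exists>k. x = walk c w ! k \<and> k \<le> length w"
    using assms(4) by (metis in_set_conv_nth length_walk less_Suc_eq_le subsetD)
  then obtain f where f: "\<forall>x\<in>set cs. x = walk c w ! f x \<and> f x \<le> length w"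
    by metis
  define ks where "ks = map f cs"
  have ks: "cs = map (\<lambda>k. walk c w ! k) ks" "set ks \<subseteq> {..length w}"
    using f by (auto simp: ks_def intro!: nth_equalityI)
  have dist: "distinct ks" using assms(3) ks(1) by (simp add: distinct_map)
  have "successively (\<lambda>i j. adjacent (walk c w ! i) (walk c w ! j)) ks"
    using assms(5) ks(1) by (simp add: successively_map)
  then have "successively (\<lambda>i j. \<bar>int j - int i\<bar> = 1) ks"
    by (rule successively_mono) (use ks(2) walk_adjacent_nth[OF assms(1,2), of _ _ c] in blast)
  then have succ: "successively (\<lambda>i j. \<bar>j - i\<bar> = 1) (map int ks)"
    by (simp add: successively_map)
  have "\<exists>a d. \<bar>d\<bar> = 1 \<and> (\<forall>i < length ks. int (ks ! i) = a + d * int i)"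
  proof (cases "ks = [] \<or> tl ks = []")
    case True
    then show ?thesis
      \<comment> \<open>With at most one index the difference is arbitrary; 1 is chosen.\<close>
      by (intro exI[of _ "int (hd ks)"] exI[of _ 1]) (cases ks; auto)
  next
    case False
    then obtain x y zs where 3: "ks = x # y # zs" by (metis list.collapse)
    have "int (ks ! i) = int x + (int y - int x) * int i" if "i < length ks" for i
    proof -
      have "distinct (map int ks)" using dist by (simp add: distinct_map)
      then have "map int ks ! i = int x + (int y - int x) * int i"
        using succ that unfolding 3 list.map
        by (intro unit_steps_arith) auto
      then show ?thesis using that by simp
    qed
    moreover have "\<bar>int y - int x\<bar> = 1" using succ 3 by simp
    ultimately show ?thesis by blast
  qed
  then show ?thesis using that ks dist by blast
qed

lemma face_connected_path:
  assumes "successively adjacent cs"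
  shows "face_connected (set cs)"
proof -
  define R where "R = {(c, d). c \<in> set cs \<and> d \<in> set cs \<and> adjacent c d}"
  \<comment> \<open>\<open>R\<close> stays fixed on all of \<open>cs\<close> while \<open>xs\<close>
    varies, so the induction can pass to tails. Any two cells are then joined through the head, by
    symmetry of \<open>R\<close>.\<close>
  have from_hd: "(hd xs, x) \<in> R\<^sup>*"
    if "x \<in> set xs" "successively adjacent xs" "set xs \<subseteq> set cs" for x xs
    using that
  proof (induction xs)
    case (Cons y xs)
    show ?case
    proof (cases "x = y")
      case False
      then have "(hd xs, x) \<in> R\<^sup>*" using Cons by (auto simp: successively_Cons)
      moreover have "(y, hd xs) \<in> R"
        using Cons.prems False by (cases xs) (auto simp: R_def)
      ultimately show ?thesis by (simp add: converse_rtrancl_into_rtrancl)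
    qed simp
  qed simp
  have "sym (R\<^sup>*)"
    by (intro sym_rtrancl symI) (auto simp: R_def adjacent_sym)
  then show ?thesis
    unfolding face_connected_def R_def[symmetric]
    using from_hd[OF _ assms] by (meson rtrancl_trans subset_refl symD)
qed

lemma degree_walk:
  assumes "admissible w" "set w \<subseteq> dirs" "x \<in> set (walk c w)"
  shows "degree_in (set (walk c w)) x \<le> 2"
proof -
  obtain i where i: "x = walk c w ! i" "i \<le> length w"
    using assms(3) by (metis in_set_conv_nth length_walk less_Suc_eq_le)
  \<comment> \<open>At the ends of the walk \<open>i - 1\<close> truncates to 0 or
    \<open>i + 1\<close> is out of range; this is harmless, as only an inclusion in a set of at most
    two cells is claimed.\<close>
  have "{d \<in> set (walk c w). adjacent x d} \<subseteq> {walk c w ! (i - 1), walk c w ! (i + 1)}"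
  proof
    fix d assume d: "d \<in> {d \<in> set (walk c w). adjacent x d}"
    then obtain j where j: "d = walk c w ! j" "j \<le> length w"
      by (metis (no_types, lifting) in_set_conv_nth length_walk less_Suc_eq_le mem_Collect_eq)
    then have "\<bar>int j - int i\<bar> = 1"
      using walk_adjacent_nth[OF assms(1,2) i(2) j(2)] d i by auto
    then have "j = i - 1 \<or> j = i + 1" by linarith
    then show "d \<in> {walk c w ! (i - 1), walk c w ! (i + 1)}" using j by auto
  qed
  then show ?thesis
    unfolding degree_in_def
    by (rule order.trans[OF card_mono, rotated]) (auto simp: card_insert_if)
qed

text \<open>The indices along a cycle would be monotone, so its first and last differ by at least 2,
  whereas the closing adjacency makes them differ by 1.\<close>

lemma no_cycle_walk:
  assumes "admissible w" "set w \<subseteq> dirs"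
  shows "\<not> is_cycle (set (walk c w)) cs"
proof
  assume cyc: "is_cycle (set (walk c w)) cs"
  then obtain ks a d where ks: "cs = map (\<lambda>k. walk c w ! k) ks" "set ks \<subseteq> {..length w}"
    "\<bar>d\<bar> = 1" "\<And>i. i < length ks \<Longrightarrow> int (ks ! i) = a + d * int i"
    using walk_indices[OF assms, of cs c] unfolding is_cycle_def by metis
  have len: "3 \<le> length ks" using cyc ks(1) by (simp add: is_cycle_def)
  then have ne: "ks \<noteq> []" by auto
  have "last ks \<le> length w" "hd ks \<le> length w"
    using ks(2) ne last_in_set hd_in_set by blast+
  then have "\<bar>int (hd ks) - int (last ks)\<bar> = 1"
    using walk_adjacent_nth[OF assms, of "last ks" "hd ks" c] cyc ne
    by (simp add: is_cycle_def ks(1) last_map hd_map)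
  moreover have "int (last ks) - int (hd ks) = d * int (length ks - 1)"
    using ks(4)[of 0] ks(4)[of "length ks - 1"] ne len by (simp add: hd_conv_nth last_conv_nth)
  ultimately show False using ks(3) len by (auto simp: abs_if split: if_splits)
qed

lemma card_walk:
  assumes "admissible w" "set w \<subseteq> dirs"
  shows "card (set (walk c w)) = Suc (length w)"
  using distinct_card[OF distinct_walk[OF assms]] by simp

lemma pds3D_set_walk:
  assumes "admissible w" "set w \<subseteq> dirs"
  shows "pds3D_set (set (walk c w))"
proof -
  have steps: "successively pd_step (walk c w)" using assms(2) by (simp add: successively_walk)
  then have "successively adjacent (walk c w)"
    by (rule successively_mono) (auto simp: pd_step_adjacent)
  then show ?thesis
    unfolding pds3D_set_def snake3D_def polyomino3D_def
    using face_connected_path degree_walk[OF assms] no_cycle_walk[OF assms]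
      distinct_walk[OF assms] steps by blast
qed

section \<open>Recovering the word from the cells\<close>

lemma is_cycle_mono: "is_cycle S cs \<Longrightarrow> S \<subseteq> T \<Longrightarrow> is_cycle T cs"
  by (auto simp: is_cycle_def)

text \<open>An immediate return repeats a cell. Letters \<open>a\<close>, \<open>b\<close>,
  \<open>- a\<close> visit the four corners of a unit square, which form a cycle.\<close>

lemma acyclic_walk_admissible:
  assumes "distinct (walk c w)" "set w \<subseteq> dirs" "\<nexists>cs. is_cycle (set (walk c w)) cs"
  shows "admissible w"
  using assms
proof (induction w arbitrary: c rule: admissible.induct)
  case (1 a b w)
  have "\<nexists>cs. is_cycle (set (walk (c + a) (b # w))) cs"
    using 1(4) is_cycle_mono[of "set (walk (c + a) (b # w))" _ "set (walk c (a # b # w))"] by auto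
  then have "admissible (b # w)" using 1(1)[of "c + a"] 1(2,3) by auto
  moreover have "b \<noteq> - a"
  proof
    assume "b = - a"
    then have "c \<in> set (walk (c + a + b) w)" by (cases w) auto
    then show False using 1(2) by auto
  qed
  moreover have "hd w \<noteq> - a" if "w \<noteq> []"
  proof
    assume "hd w = - a"
    then obtain v where w: "w = (- a) # v" using \<open>w \<noteq> []\<close> by (cases w) auto
    have last: "c + a + b + - a = c + b" by simp
    then have in_walk: "c + b \<in> set (walk (c + a + b + - a) v)" by (cases v) auto
    then have "set [c, c + a, c + a + b, c + b] \<subseteq> set (walk c (a # b # w))"
      unfolding w by auto
    moreover have "distinct [c, c + a, c + a + b, c + b]"
      using 1(2) in_walk unfolding w by auto
    moreover have "a \<in> dirs" "b \<in> dirs" using 1(3) by auto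
    ultimately have "is_cycle (set (walk c (a # b # w))) [c, c + a, c + a + b, c + b]"
      unfolding is_cycle_def by (auto simp: adjacent_iff)
    then show False using 1(4) by blast
  qed
  ultimately show ?case by auto
qed auto

text \<open>Converse of \<open>pds3D_set_walk\<close>: together they identify the nonempty directed
  snakes with the cell sets of admissible walks.\<close>

lemma pds3D_set_obtain_walk:
  assumes "pds3D_set S" "S \<noteq> {}"
  obtains c w where "S = set (walk c w)" "admissible w" "set w \<subseteq> dirs"
proof -
  obtain cs where cs: "distinct cs" "set cs = S" "successively pd_step cs" and sn: "snake3D S"
    using assms(1) unfolding pds3D_set_def by blast
  obtain w where w: "cs = walk (hd cs) w" using walk_of_steps[of cs] cs(2) assms(2) by auto
  then have "set w \<subseteq> dirs" using cs(3) successively_walk by metis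
  moreover have "admissible w"
    using acyclic_walk_admissible[of "hd cs" w] calculation cs sn w unfolding snake3D_def by metis
  ultimately show ?thesis using that w cs(2) by metis
qed

text \<open>By \<open>walk_indices\<close> the second walk runs through indices of the first in
  steps of 1 or -1. It has as many terms as there are indices, so it must start at one end and
  finish at the other.\<close>

lemma same_cells_walk:
  assumes w: "admissible w" "set w \<subseteq> dirs" and w': "admissible w'" "set w' \<subseteq> dirs"
    and eq: "set (walk c' w') = set (walk c w)"
  shows "walk c' w' = walk c w \<or> walk c' w' = rev (walk c w)"
proof -
  have len: "length w' = length w"
    using eq card_walk[OF w, of c] card_walk[OF w', of c'] by simp
  have "successively adjacent (walk c' w')"
    by (rule successively_mono[of pd_step]) (use w' successively_walk pd_step_adjacent in auto)
  then obtain ks a d where ks: "walk c' w' = map (\<lambda>k. walk c w ! k) ks"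
    "set ks \<subseteq> {..length w}" "\<bar>d\<bar> = 1" "\<And>i. i < length ks \<Longrightarrow> int (ks ! i) = a + d * int i"
    using walk_indices[OF w distinct_walk[OF w'], of c' c] eq by (metis order_refl)
  have lenk: "length ks = Suc (length w)"
    using arg_cong[OF ks(1), of length] len by simp
  then have "0 < length ks" "length w < length ks" by auto
  then have "ks ! 0 \<le> length w" "ks ! length w \<le> length w"
    using ks(2) nth_mem[of 0 ks] nth_mem[of "length w" ks] by blast+
  moreover have "int (ks ! 0) = a" "int (ks ! length w) = a + d * int (length w)"
    using ks(4)[of 0] ks(4)[of "length w"] lenk by auto
  moreover have "d = 1 \<or> d = - 1" using ks(3) by linarith
  ultimately consider "d = 1" "a = 0" | "d = - 1" "a = int (length w)" by auto
  then show ?thesis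
  proof cases
    case 1
    then have "ks ! i = i" if "i \<le> length w" for i using ks(4)[of i] lenk that by auto
    then have "walk c' w' = walk c w"
      unfolding ks(1) using lenk by (intro nth_equalityI) auto
    then show ?thesis ..
  next
    case 2
    then have "ks ! i = length w - i" if "i \<le> length w" for i using ks(4)[of i] lenk that by auto
    then have "walk c' w' = rev (walk c w)"
      unfolding ks(1) using lenk by (intro nth_equalityI) (auto simp: rev_nth)
    then show ?thesis ..
  qed
qed

lemma reversed_steps:
  assumes "successively (\<lambda>x y. pd_step y x) (walk c w)"
  shows "\<forall>d\<in>set w. - d \<in> dirs"
  using assms
proof (induction w arbitrary: c)
  case (Cons d w)
  then show ?case using Cons.IH[of "c + d"] by (simp add: successively_Cons pd_step_iff)
qed simp

text \<open>Letters whose opposites are also directions are horizontal, and admissibility keeps the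
  sign from changing.\<close>

lemma admissible_horizontal:
  assumes "admissible w" "set w \<subseteq> dirs" "\<forall>d\<in>set w. - d \<in> dirs"
  shows "w = replicate (length w) (1,0,0) \<or> w = replicate (length w) (-1,0,0)"
  using assms
proof (induction w rule: admissible.induct)
  case (1 a b w)
  then have "a \<in> dirs" "- a \<in> dirs" "b \<in> dirs" "- b \<in> dirs" "b \<noteq> - a" by auto
  then have "b = a" by (auto simp: dirs_def)
  then show ?case using 1 by (auto simp del: split_paired_All)
qed (auto simp: dirs_def)

lemma reversed_walks_horizontal:
  assumes "admissible w" "set w \<subseteq> dirs" "admissible w'" "set w' \<subseteq> dirs"
    and "walk c' w' = rev (walk c w)"
  shows "w = replicate (length w) (1,0,0) \<or> w = replicate (length w) (-1,0,0)"
proof (intro admissible_horizontal[OF assms(1,2)] reversed_steps)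
  have "successively pd_step (rev (walk c w))"
    using successively_walk assms(4,5) by metis
  then show "successively (\<lambda>x y. pd_step y x) (walk c w)" by (simp add: successively_rev)
qed

lemma set_walk_right:
  "set (walk (x, y, z) (replicate m (1,0,0))) = (\<lambda>i. (i, y, z)) ` {x..x + int m}"
proof (induction m arbitrary: x)
  case (Suc m)
  have "{x..x + int (Suc m)} = insert x {x + 1..x + 1 + int m}" by auto
  then show ?case using Suc[of "x + 1"] by simp
qed auto

lemma set_walk_left:
  "set (walk (x, y, z) (replicate m (-1,0,0))) = (\<lambda>i. (i, y, z)) ` {x - int m..x}"
proof (induction m arbitrary: x)
  case (Suc m)
  have "{x - int (Suc m)..x} = insert x {x - 1 - int m..x - 1}" by auto
  then show ?case using Suc[of "x - 1"] by simp
qed auto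


section \<open>Translation classes\<close>

lemma translation_rel_iff: "(A, B) \<in> translation_rel \<longleftrightarrow> (\<exists>t. B = (\<lambda>c. c + t) ` A)"
  by (simp add: translation_rel_def)

lemma equiv_translation: "equiv UNIV translation_rel"
proof (intro equivI refl_onI symI transI)
  show "(A, A) \<in> translation_rel" for A
    unfolding translation_rel_iff by (rule exI[of _ 0]) simp
next
  fix A B assume "(A, B) \<in> translation_rel"
  then obtain t where "B = (\<lambda>c. c + t) ` A" unfolding translation_rel_iff by blast
  then have "A = (\<lambda>c. c + - t) ` B" by (simp add: image_image)
  then show "(B, A) \<in> translation_rel" unfolding translation_rel_iff by blast
next
  fix A B C assume "(A, B) \<in> translation_rel" "(B, C) \<in> translation_rel"
  then obtain s t where "B = (\<lambda>c. c + s) ` A" "C = (\<lambda>c. c + t) ` B"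
    unfolding translation_rel_iff by blast
  then have "C = (\<lambda>c. c + (s + t)) ` A" by (simp add: image_image add.assoc)
  then show "(A, C) \<in> translation_rel" unfolding translation_rel_iff by blast
qed auto

definition words :: "nat \<Rightarrow> cell list set" where
  "words m = {w. set w \<subseteq> dirs \<and> length w = m \<and> admissible w}"

definition walk_class :: "cell list \<Rightarrow> cell set set" where
  "walk_class w = translation_rel `` {set (walk 0 w)}"

lemma translate_set_walk: "(\<lambda>x. x + t) ` set (walk c w) = set (walk (c + t) w)"
  by (metis list.set_map map_walk)

lemma walk_class_eq_iff:
  "walk_class w = walk_class w' \<longleftrightarrow> (\<exists>t. set (walk 0 w') = set (walk t w))"
proof -
  have "walk_class w = walk_class w' \<longleftrightarrow> (set (walk 0 w), set (walk 0 w')) \<in> translation_rel"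
    unfolding walk_class_def using eq_equiv_class_iff[OF equiv_translation] by simp
  then show ?thesis by (simp only: translation_rel_iff translate_set_walk add_0)
qed

text \<open>A walk from \<open>c\<close> is the walk from the origin translated by \<open>c\<close>,
  so a class depends on the word only. The word has one letter fewer than the snake has
  cells.\<close>

lemma pds3D_quotient:
  "{S. pds3D_set S \<and> card S = Suc m} // translation_rel = walk_class ` words m"
proof -
  have "translation_rel `` {set (walk c w)} = walk_class w" for c w
  proof -
    have "set (walk c w) = (\<lambda>x. x + c) ` set (walk 0 w)" by (simp only: translate_set_walk add_0)
    then have "(set (walk 0 w), set (walk c w)) \<in> translation_rel"
      unfolding translation_rel_iff by blast
    then show ?thesis
      unfolding walk_class_def by (rule equiv_class_eq[OF equiv_translation, symmetric])
  qed
  moreover have "{S. pds3D_set S \<and> card S = Suc m} = (\<Union>w\<in>words m. range (\<lambda>c. set (walk c w)))"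
  proof (intro equalityI subsetI)
    fix S assume S: "S \<in> {S. pds3D_set S \<and> card S = Suc m}"
    then have "pds3D_set S" "S \<noteq> {}" by auto
    then obtain c w where w: "S = set (walk c w)" "admissible w" "set w \<subseteq> dirs"
      by (rule pds3D_set_obtain_walk)
    then have "w \<in> words m" using S card_walk[OF w(2,3), of c] by (simp add: words_def)
    then show "S \<in> (\<Union>w\<in>words m. range (\<lambda>c. set (walk c w)))" using w(1) by blast
  qed (auto simp: words_def pds3D_set_walk card_walk)
  ultimately show ?thesis by (auto simp: quotient_def)
qed

lemma replicate_words: "a \<in> {(1,0,0), (-1,0,0)} \<Longrightarrow> replicate m a \<in> words m"
proof -
  assume a: "a \<in> {(1,0,0), (-1,0,0)}"
  then have "admissible (replicate m a)"
  proof (induction m)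
    case (Suc m)
    then show ?case by (cases m rule: old.nat.exhaust; cases "m - 1") auto
  qed simp
  then show ?thesis using a by (auto simp: words_def dirs_def)
qed

lemma walk_class_horizontal:
  "walk_class (replicate m (1,0,0)) = walk_class (replicate m (-1,0,0))"
  unfolding walk_class_eq_iff
  \<comment> \<open>The run to the right from x-coordinate \<open>- m\<close> covers the same cells
    as the run to the left from the origin.\<close>
  by (intro exI[of _ "(- int m, 0, 0)"]) (simp add: zero_prod_def set_walk_right set_walk_left)

text \<open>Two words of one class give equal or mutually reversed walks. In the reversed case both
  words are horizontal runs, and with the left run removed both are the right run.\<close>

lemma walk_class_inj: "inj_on walk_class (words m - {replicate m (-1,0,0)})"
proof (rule inj_onI)
  fix w w' assume w: "w \<in> words m - {replicate m (-1,0,0)}"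
    and w': "w' \<in> words m - {replicate m (-1,0,0)}" and "walk_class w = walk_class w'"
  then obtain t where eq: "set (walk 0 w') = set (walk t w)" by (auto simp: walk_class_eq_iff)
  have adm: "admissible w" "set w \<subseteq> dirs" "admissible w'" "set w' \<subseteq> dirs"
    and len: "length w = m" "length w' = m"
    using w w' by (auto simp: words_def)
  show "w = w'"
  proof (cases "walk 0 w' = walk t w")
    case True
    then show ?thesis by (simp add: walk_inj)
  next
    case False
    then have rev: "walk 0 w' = rev (walk t w)" using same_cells_walk[OF adm eq] by auto
    then have "walk t w = rev (walk 0 w')" by simp
    then have "w' = replicate m (1,0,0)"
      using reversed_walks_horizontal[OF adm(3,4,1,2)] w' len by auto
    moreover have "w = replicate m (1,0,0)"
      using reversed_walks_horizontal[OF adm rev] w len by auto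
    ultimately show ?thesis by simp
  qed
qed

text \<open>The two horizontal runs share a class, whence the subtraction. With no letters they are
  the same word, so a single cell is treated separately.\<close>

lemma pds3D_eq_words: "pds3D (Suc (Suc m)) = card (words (Suc m)) - 1"
proof -
  let ?W = "words (Suc m)" and ?l = "replicate (Suc m) (-1,0,0) :: cell list"
  have "walk_class ?l \<in> walk_class ` (?W - {?l})"
    unfolding walk_class_horizontal[symmetric]
    by (intro imageI) (use replicate_words[of "(1,0,0)" "Suc m"] in auto)
  then have "walk_class ` ?W = walk_class ` (?W - {?l})" by auto
  then show ?thesis
    unfolding pds3D_def pds3D_quotient using walk_class_inj[of "Suc m"] replicate_words[of _ "Suc m"]
    by (simp add: card_image del: replicate.simps)
qed

lemma pds3D_1: "pds3D 1 = 1"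
proof -
  have "words 0 = {[]}" by (auto simp: words_def)
  then show ?thesis unfolding pds3D_def using pds3D_quotient[of 0] by simp
qed

lemma pds3D_0: "pds3D 0 = 1"
proof -
  have "pds3D_set {}"
    by (auto simp: pds3D_set_def snake3D_def polyomino3D_def face_connected_def is_cycle_def)
  \<comment> \<open>Finiteness is needed because infinite sets also have \<open>card\<close>
    0.\<close>
  moreover have "finite S" if "pds3D_set S" for S
    using that by (auto simp: pds3D_set_def snake3D_def polyomino3D_def)
  ultimately have "{S. pds3D_set S \<and> card S = 0} = {{}}" by auto
  then show ?thesis by (simp add: pds3D_def quotient_def)
qed



section \<open>Counting words\<close>

text \<open>The predicate is a parameter so that stripping a first letter \<open>d\<close> leads to
  a count of the same kind, for the words \<open>w\<close> with \<open>P (d # w)\<close>.\<close>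

definition count :: "(cell list \<Rightarrow> bool) \<Rightarrow> nat \<Rightarrow> nat" where
  "count P m = card {w. set w \<subseteq> dirs \<and> length w = m \<and> P w}"

lemma count_0: "count P 0 = (if P [] then 1 else 0)"
proof -
  have "{w. set w \<subseteq> dirs \<and> length w = 0 \<and> P w} = (if P [] then {[]} else {})" by auto
  then show ?thesis by (simp add: count_def)
qed

lemma count_cong: "(\<And>w. set w \<subseteq> dirs \<Longrightarrow> P w \<longleftrightarrow> Q w) \<Longrightarrow> count P m = count Q m"
  unfolding count_def by (intro arg_cong[of _ _ card]) blast

lemma count_False: "count (\<lambda>w. False) m = 0"
  by (simp add: count_def)

lemma count_Suc: "count P (Suc m) = (\<Sum>d\<in>dirs. count (\<lambda>w. P (d # w)) m)"
proof -
  let ?A = "\<lambda>d. {w. set w \<subseteq> dirs \<and> length w = m \<and> P (d # w)}"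
  have fin: "finite (?A d)" for d
    by (rule finite_subset[OF _ finite_lists_length_eq[of dirs m]]) (auto simp: dirs_def)
  have "{w. set w \<subseteq> dirs \<and> length w = Suc m \<and> P w} = (\<Union>d\<in>dirs. (#) d ` ?A d)"
  proof (intro equalityI subsetI)
    fix w assume "w \<in> {w. set w \<subseteq> dirs \<and> length w = Suc m \<and> P w}"
    then show "w \<in> (\<Union>d\<in>dirs. (#) d ` ?A d)" by (cases w) auto
  qed auto
  also have "card \<dots> = (\<Sum>d\<in>dirs. card ((#) d ` ?A d))"
  proof (rule card_UN_disjoint)
    show "finite dirs" by (simp add: dirs_def)
    show "\<forall>d\<in>dirs. finite ((#) d ` ?A d)" using fin by blast
    show "\<forall>d\<in>dirs. \<forall>e\<in>dirs. d \<noteq> e \<longrightarrow> (#) d ` ?A d \<inter> (#) e ` ?A e = {}" by blast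
  qed
  also have "\<dots> = (\<Sum>d\<in>dirs. count (\<lambda>w. P (d # w)) m)"
    by (simp add: count_def card_image)
  finally show ?thesis by (simp add: count_def)
qed

lemma sum_dirs: "(\<Sum>d\<in>dirs. f d) = f (1,0,0) + f (-1,0,0) + f (0,1,0) + (f (0,0,1) :: nat)"
  by (simp add: dirs_def)

definition horizontal :: "cell \<Rightarrow> bool" where
  "horizontal a \<longleftrightarrow> a \<in> {(1,0,0), (-1,0,0)}"

definition upward :: "cell \<Rightarrow> bool" where
  "upward b \<longleftrightarrow> b \<in> {(0,1,0), (0,0,1)}"

lemma admissible_upward_Cons:
  assumes "upward b" "set w \<subseteq> dirs"
  shows "admissible (b # w) \<longleftrightarrow> admissible w"
proof (cases w)
  case (Cons c v)
  then show ?thesis using assms by (cases v) (auto simp: upward_def dirs_def)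
qed simp

lemma admissible_same_Cons: "horizontal a \<Longrightarrow> admissible (a # a # w) \<longleftrightarrow> admissible (a # w)"
  by (cases w) (auto simp: horizontal_def)

lemma not_admissible_opposite: "\<not> admissible (a # - a # w)"
  by simp

lemma not_admissible_opposite2: "\<not> admissible (a # b # - a # w)"
  by simp

lemma admissible_between_same:
  assumes "horizontal a" "upward b" "set w \<subseteq> dirs"
  shows "admissible (a # b # a # w) \<longleftrightarrow> admissible (a # w)"
  using assms by (cases w) (auto simp: horizontal_def upward_def dirs_def)

text \<open>Tests look back two letters only, so two upward letters erase the memory of
  \<open>a\<close>.\<close>

lemma admissible_two_upward:
  assumes "horizontal a" "upward b" "upward c" "set w \<subseteq> dirs"
  shows "admissible (a # b # c # w) \<longleftrightarrow> admissible w"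
proof -
  have "admissible (a # b # c # w) \<longleftrightarrow> admissible (c # w)"
    using assms admissible_upward_Cons[of b "c # w"]
    by (auto simp: horizontal_def upward_def dirs_def)
  then show ?thesis using admissible_upward_Cons[OF assms(3,4)] by simp
qed

text \<open>The three states of the transfer recursion, by what still constrains the next letters:
  nothing, a horizontal letter just read, or a horizontal letter followed by an upward one.\<close>

abbreviation "free_count \<equiv> count admissible"

abbreviation "after_x a \<equiv> count (\<lambda>w. admissible (a # w))"

abbreviation "after_x_up a b \<equiv> count (\<lambda>w. admissible (a # b # w))"

lemma free_count_Suc:
  "free_count (Suc m) = 2 * free_count m + after_x (1,0,0) m + after_x (-1,0,0) m"
proof -
  have "after_x b m = free_count m" if "upward b" for b
    using admissible_upward_Cons[OF that] by (rule count_cong)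
  then show ?thesis by (simp add: count_Suc sum_dirs upward_def)
qed

lemma after_x_Suc:
  assumes "horizontal a"
  shows "after_x a (Suc m) = after_x a m + after_x_up a (0,1,0) m + after_x_up a (0,0,1) m"
proof -
  have "after_x_up a a m = after_x a m"
    using admissible_same_Cons[OF assms] by (intro count_cong)
  moreover have "after_x_up a (- a) m = 0"
    by (simp only: not_admissible_opposite count_False)
  ultimately show ?thesis
    using assms unfolding count_Suc sum_dirs horizontal_def by auto
qed

lemma after_x_up_Suc:
  assumes "horizontal a" "upward b"
  shows "after_x_up a b (Suc m) = after_x a m + 2 * free_count m"
proof -
  let ?f = "\<lambda>c. count (\<lambda>w. admissible (a # b # c # w)) m"
  have "?f a = after_x a m"
    using admissible_between_same[OF assms] by (rule count_cong)
  moreover have "?f (- a) = 0"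
    by (simp only: not_admissible_opposite2 count_False)
  moreover have "?f c = free_count m" if "upward c" for c
    using admissible_two_upward[OF assms that] by (rule count_cong)
  then have "?f (0,1,0) = free_count m" "?f (0,0,1) = free_count m"
    by (auto simp: upward_def)
  ultimately show ?thesis
    using assms(1) unfolding count_Suc sum_dirs horizontal_def by auto
qed

text \<open>Let N be the free count and X the sum of \<open>after_x\<close> over both horizontal
  letters. Then X(m+2) = X(m+1) + 2 X(m) + 8 N(m) and X(m) = N(m+1) - 2 N(m); eliminating X gives
  the recurrence.\<close>

lemma free_count_rec: "free_count (m + 3) = 3 * free_count (m + 2) + 4 * free_count m"
proof -
  have "after_x a (m + 2) = after_x a (m + 1) + 2 * after_x a m + 4 * free_count m"
    if "horizontal a" for a
    using after_x_Suc[OF that, of "m + 1"] after_x_up_Suc[OF that, of _ m]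
    by (simp add: upward_def)
  from this[of "(1,0,0)"] this[of "(-1,0,0)"] show ?thesis
    using free_count_Suc[of m] free_count_Suc[of "m + 1"] free_count_Suc[of "m + 2"]
    by (simp add: horizontal_def numeral_eq_Suc)
qed

lemma free_count_init: "free_count 0 = 1" "free_count 1 = 4" "free_count 2 = 14"
proof -
  have x: "after_x a 0 = 1" "after_x a 1 = 3" if "horizontal a" for a
    using after_x_Suc[OF that, of 0] that by (auto simp: count_0 horizontal_def)
  show 0: "free_count 0 = 1" by (simp add: count_0)
  show 1: "free_count 1 = 4"
    using free_count_Suc[of 0] x 0 by (simp add: horizontal_def)
  show "free_count 2 = 14"
    using free_count_Suc[of 1] x 1 by (simp add: horizontal_def numeral_2_eq_2)
qed

lemma pds3D_eq_free_count: "pds3D (Suc (Suc m)) = free_count (Suc m) - 1"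
  by (simp add: pds3D_eq_words words_def count_def)

text \<open>Makes the natural subtraction in \<open>pds3D_eq_free_count\<close> a genuine
  one.\<close>

lemma free_count_pos: "1 \<le> free_count m"
  by (induction m) (auto simp: free_count_init(1) free_count_Suc)

lemma pds3D_plus_1:
  assumes "2 \<le> n"
  shows "pds3D n + 1 = free_count (n - 1)"
proof -
  obtain m where m: "n = Suc (Suc m)"
    using assms by (metis add_2_eq_Suc le_Suc_ex)
  show ?thesis unfolding m using free_count_pos[of "Suc m"] by (simp add: pds3D_eq_free_count)
qed

text \<open>This is \<open>free_count_rec\<close> for \<open>pds3D n + 1\<close>; the constant is 3
  + 4 - 1. The bound 5 makes \<open>n - 3\<close> at least 2, as \<open>pds3D_plus_1\<close>
  requires.\<close>

lemma pds3D_rec: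
  assumes "5 \<le> n"
  shows "pds3D n = 3 * pds3D (n - 1) + 4 * pds3D (n - 3) + 6"
proof -
  have "n - 4 + 3 = n - 1" "n - 4 + 2 = n - 2" using assms by auto
  then have "free_count (n - 1) = 3 * free_count (n - 2) + 4 * free_count (n - 4)"
    using free_count_rec[of "n - 4"] by (simp only:)
  moreover have "n - 1 - 1 = n - 2" "n - 3 - 1 = n - 4" by auto
  ultimately show ?thesis
    using assms pds3D_plus_1[of n] pds3D_plus_1[of "n - 1"] pds3D_plus_1[of "n - 3"]
    by (simp only:) linarith
qed

lemma pds3D_values: "pds3D 2 = 3" "pds3D 3 = 13" "pds3D 4 = 45"
proof -
  have "free_count 3 = 46" using free_count_rec[of 0, unfolded add_0] free_count_init by linarith
  then show "pds3D 2 = 3" "pds3D 3 = 13" "pds3D 4 = 45"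
    using pds3D_plus_1[of 2] pds3D_plus_1[of 3] pds3D_plus_1[of 4] free_count_init by simp_all
qed

section \<open>The generating function\<close>

unbundle fps_syntax

lemma pds3D_gf:
  "Abs_fps (\<lambda>n. of_nat (pds3D n) :: rat) =
      (4 * fps_X ^ 5 + 2 * fps_X ^ 4 + 2 * fps_X ^ 2 - 3 * fps_X + 1) /
      ((1 - fps_X) * (1 - 3 * fps_X - 4 * fps_X ^ 3))"
proof -
  define F where "F = Abs_fps (\<lambda>n. of_nat (pds3D n) :: rat)"
  define D :: "rat fps" where "D = (1 - fps_X) * (1 - 3 * fps_X - 4 * fps_X ^ 3)"
  have nth: "F $ n = of_nat (pds3D n)" for n by (simp add: F_def)
  have "D $ 0 = 1" by (simp add: D_def)
  then have "D \<noteq> 0" by auto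
  \<comment> \<open>The denominator expands to 1 - 4q + 3q^2 - 4q^3 + 4q^4. Every shift is written
    with an explicit power, exponent 1 included, so that one coefficient rule reads them
    all.\<close>
  have "F * D = F - fps_const 4 * (F * fps_X ^ 1) + fps_const 3 * (F * fps_X ^ 2)
      - fps_const 4 * (F * fps_X ^ 3) + fps_const 4 * (F * fps_X ^ 4)"
    by (simp add: D_def fps_numeral_fps_const[symmetric] algebra_simps power_numeral_reduce)
  moreover have "4 * fps_X ^ 5 + 2 * fps_X ^ 4 + 2 * fps_X ^ 2 - 3 * fps_X + (1 :: rat fps) =
      fps_const 4 * fps_X ^ 5 + fps_const 2 * fps_X ^ 4 + fps_const 2 * fps_X ^ 2
      - fps_const 3 * fps_X ^ 1 + fps_X ^ 0"
    by (simp add: fps_numeral_fps_const)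
  moreover have "\<dots> = F - fps_const 4 * (F * fps_X ^ 1) + fps_const 3 * (F * fps_X ^ 2)
      - fps_const 4 * (F * fps_X ^ 3) + fps_const 4 * (F * fps_X ^ 4)"
  proof (rule fps_ext)
    fix n :: nat
    note v = pds3D_0 pds3D_1[unfolded One_nat_def] pds3D_values
    consider "n = 0" | "n = 1" | "n = 2" | "n = 3" | "n = 4" | "n = 5" | "6 \<le> n" by linarith
    then show "(fps_const 4 * fps_X ^ 5 + fps_const 2 * fps_X ^ 4 + fps_const 2 * fps_X ^ 2
        - fps_const 3 * fps_X ^ 1 + fps_X ^ 0) $ n =
      (F - fps_const 4 * (F * fps_X ^ 1) + fps_const 3 * (F * fps_X ^ 2)
        - fps_const 4 * (F * fps_X ^ 3) + fps_const 4 * (F * fps_X ^ 4)) $ n"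
    proof cases
      case 6
      then show ?thesis using pds3D_rec[of 5]
        by (simp add: fps_X_power_mult_right_nth nth v del: power_Suc power_one_right)
    next
      \<comment> \<open>Subtracting the recurrence at \<open>n - 1\<close> from that at
        \<open>n\<close> cancels the constant 6; this is the effect of the factor 1 - q.\<close>
      case 7
      then have "n - Suc 0 - 3 = n - 4" "n - Suc 0 - 1 = n - 2" by auto
      then show ?thesis using pds3D_rec[of n] pds3D_rec[of "n - 1"] 7
        by (simp add: fps_X_power_mult_right_nth nth del: power_Suc power_one_right)
    qed (simp_all add: fps_X_power_mult_right_nth nth v del: power_Suc power_one_right)
  qed
  ultimately have "F * D = 4 * fps_X ^ 5 + 2 * fps_X ^ 4 + 2 * fps_X ^ 2 - 3 * fps_X + 1"
    by simp
  then show ?thesis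
    unfolding F_def[symmetric] D_def[symmetric] using \<open>D \<noteq> 0\<close>
    by (metis nonzero_mult_div_cancel_right)
qed


section \<open>The characteristic roots\<close>

text \<open>Distinctness matters because the sum in the theorem runs over the set of roots. It comes
  from the absence of common roots with the derivative; the symmetric functions come from comparing
  coefficients.\<close>

lemma roots_vieta:
  obtains a b c :: complex where "{\<alpha>. 1 - 3 * \<alpha> - 4 * \<alpha> ^ 3 = 0} = {a, b, c}" "distinct [a, b, c]"
    "a + b + c = 0" "a * b + b * c + c * a = 3 / 4" "a * b * c = 1 / 4"
proof -
  define p :: "complex poly" where "p = [:1, -3, 0, -4:]"
  have poly_p: "poly p z = 1 - 3 * z - 4 * z ^ 3" for z
    by (simp add: p_def algebra_simps power3_eq_cube)
  have deg: "degree p = 3" and lead: "lead_coeff p = - 4" by (auto simp: p_def)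
  have "rsquarefree p"
    unfolding rsquarefree_roots
  proof (intro allI notI, elim conjE)
    fix z assume z: "poly p z = 0" "poly (pderiv p) z = 0"
    \<comment> \<open>Inserting the first equation into the second leaves 1 - 2z = 0, and z = 1/2
      violates the first.\<close>
    then have sq: "4 * z ^ 2 = - 1" and "1 - 3 * z - 4 * z ^ 2 * z = 0"
      by (auto simp: p_def pderiv_pCons algebra_simps power2_eq_square power3_eq_cube)
    then have "z = 1 / 2" by (simp add: field_simps)
    then have "4 * (1 / 2 :: complex) ^ 2 = - 1" using sq by (simp only:)
    then show False by (simp add: power2_eq_square)
  qed
  then have fact: "smult (- 4) (\<Prod>z\<in>{z. poly p z = 0}. [:- z, 1:]) = p"
    using complex_poly_decompose_rsquarefree lead by metis
  have "degree p = card {z. poly p z = 0}"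
    by (subst fact[symmetric]) (simp add: degree_prod_eq_sum_degree)
  then obtain a b c where abc: "{z. poly p z = 0} = {a, b, c}" "distinct [a, b, c]"
    using deg by (auto simp: card_3_iff)
  have "(\<Prod>z\<in>{a, b, c}. [:- z, 1:]) = [:- a, 1:] * [:- b, 1:] * [:- c, 1:]"
    using abc(2) by (simp add: mult.assoc del: mult_pCons_left mult_pCons_right)
  then have "smult (- 4) ([:- a, 1:] * [:- b, 1:] * [:- c, 1:]) = [:1, -3, 0, -4:]"
    using fact unfolding abc(1) by (simp only: p_def)
  moreover have "smult (- 4) ([:- a, 1:] * [:- b, 1:] * [:- c, 1:]) =
      [:4 * (a * b * c), - 4 * (a * b + b * c + c * a), 4 * (a + b + c), -4:]"
    by (simp add: algebra_simps)
  moreover have quarter: "x = r / 4" if "4 * x = r" for x r :: complex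
    using that by auto
  ultimately have "[:4 * (a * b * c), - 4 * (a * b + b * c + c * a), 4 * (a + b + c), -4:] =
      [:1, -3, 0, -4:]"
    by (simp only:)
  then have "4 * (a + b + c) = 0" "4 * (a * b + b * c + c * a) = 3" "4 * (a * b * c) = 1"
    by (simp_all only: pCons_eq_iff mult_minus_left neg_equal_iff_equal)
  then have "a + b + c = 0" "a * b + b * c + c * a = 3 / 4" "a * b * c = 1 / 4"
    using quarter[of "a + b + c" 0] quarter by (simp, blast+)
  moreover have "{\<alpha>. 1 - 3 * \<alpha> - 4 * \<alpha> ^ 3 = 0} = {a, b, c}" using abc(1) by (simp only: poly_p)
  ultimately show ?thesis using that abc(2) by blast
qed

text \<open>The inverse roots satisfy t^3 = 3t^2 + 4, the characteristic equation of
  \<open>free_count_rec\<close>. Both sides thus obey one recurrence, and the three initial values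
  are power sums of the inverse roots.\<close>

lemma root_sum_formula:
  "of_nat (free_count m) =
      1 / 12 * (\<Sum>\<alpha>\<in>{\<alpha>::complex. 1 - 3 * \<alpha> - 4 * \<alpha> ^ 3 = 0}.
        (inverse \<alpha> + 1) * inverse \<alpha> ^ Suc m)"
proof -
  obtain a b c :: complex where roots: "{\<alpha>. 1 - 3 * \<alpha> - 4 * \<alpha> ^ 3 = 0} = {a, b, c}"
    and dist: "distinct [a, b, c]"
    and e: "a + b + c = 0" "a * b + b * c + c * a = 3 / 4" "a * b * c = 1 / 4"
    by (rule roots_vieta)
  define x y z where "x = inverse a" and "y = inverse b" and "z = inverse c"
  have nz: "a \<noteq> 0" "b \<noteq> 0" "c \<noteq> 0" using e(3) by auto
  \<comment> \<open>As the product of the roots is 1/4, inverses become polynomials in the roots,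
    and the symmetric functions of \<open>x\<close>, \<open>y\<close>, \<open>z\<close> follow by
    algebra.\<close>
  have inv: "x = 4 * (b * c)" "y = 4 * (c * a)" "z = 4 * (a * b)"
    using e(3) nz by (auto simp: x_def y_def z_def field_simps)
  have s: "x + y + z = 3" "x * y + y * z + z * x = 0" "x * y * z = 4"
  proof -
    show "x + y + z = 3" using e(2) unfolding inv by algebra
    show "x * y + y * z + z * x = 0" using e(1) unfolding inv by algebra
    show "x * y * z = 4" using e(3) unfolding inv by algebra
  qed
  have cube: "t ^ 3 = 3 * t ^ 2 + 4" if "t = x \<or> t = y \<or> t = z" for t
  proof -
    have "(t - x) * (t - y) * (t - z) =
        t ^ 3 - (x + y + z) * t ^ 2 + (x * y + y * z + z * x) * t - x * y * z"
      by (simp add: algebra_simps power2_eq_square power3_eq_cube)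
    moreover have "(t - x) * (t - y) * (t - z) = 0" using that by auto
    ultimately have "t ^ 3 - 3 * t ^ 2 + 0 * t - 4 = 0" unfolding s by (simp only:)
    then show ?thesis by (simp add: diff_eq_eq)
  qed
  define f where "f t m = (t + 1) * t ^ Suc m" for t :: complex and m
  have f_rec: "f t (m + 3) = 3 * f t (m + 2) + 4 * f t m" if "t = x \<or> t = y \<or> t = z" for t m
  proof -
    have "f t (m + 3) = (t + 1) * t ^ Suc m * t ^ 3" by (simp add: f_def eval_nat_numeral)
    also have "\<dots> = (t + 1) * t ^ Suc m * (3 * t ^ 2 + 4)" by (simp only: cube[OF that])
    also have "\<dots> = 3 * f t (m + 2) + 4 * f t m"
      by (simp add: f_def eval_nat_numeral algebra_simps)
    finally show ?thesis .
  qed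
  have "12 * of_nat (free_count m) = f x m + f y m + f z m"
  proof (induction m rule: less_induct)
    case (less m)
    have p2: "x ^ 2 + y ^ 2 + z ^ 2 = 9"
    proof -
      have "x ^ 2 + y ^ 2 + z ^ 2 = (x + y + z) ^ 2 - 2 * (x * y + y * z + z * x)"
        by (simp add: algebra_simps power2_eq_square)
      then show ?thesis unfolding s by simp
    qed
    have p3: "x ^ 3 + y ^ 3 + z ^ 3 = 39"
    proof -
      have "x ^ 3 + y ^ 3 + z ^ 3 = 3 * (x ^ 2 + y ^ 2 + z ^ 2) + 12" by (simp add: cube)
      then show ?thesis unfolding p2 by simp
    qed
    consider "m = 0" | "m = 1" | "m = 2" | "3 \<le> m" by linarith
    then show ?case
    proof cases
      case 1
      have "f x 0 + f y 0 + f z 0 = (x ^ 2 + y ^ 2 + z ^ 2) + (x + y + z)"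
        by (simp add: f_def algebra_simps power2_eq_square)
      then show ?thesis using 1 p2 s(1) free_count_init(1) by simp
    next
      case 2
      have "f x 1 + f y 1 + f z 1 = (x ^ 3 + y ^ 3 + z ^ 3) + (x ^ 2 + y ^ 2 + z ^ 2)"
        by (simp add: f_def algebra_simps power2_eq_square power3_eq_cube)
      then show ?thesis using 2 p2 p3 free_count_init(2) by simp
    next
      case 3
      \<comment> \<open>The cubic relation reduces the fourth power, so no fourth power sum is
        needed.\<close>
      have "f t 2 = 4 * t ^ 3 + 4 * t" if "t = x \<or> t = y \<or> t = z" for t
      proof -
        have "f t 2 = t ^ 3 * t + t ^ 3" by (simp add: f_def algebra_simps power3_eq_cube numeral_2_eq_2)
        also have "t ^ 3 * t = 3 * t ^ 3 + 4 * t"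
          unfolding cube[OF that] by (subst cube[OF that, symmetric]) (use cube[OF that] in algebra)
        finally show ?thesis by simp
      qed
      from this[of x] this[of y] this[of z]
      have "f x 2 + f y 2 + f z 2 = 4 * (x ^ 3 + y ^ 3 + z ^ 3) + 4 * (x + y + z)" by simp
      then show ?thesis using 3 p3 s(1) free_count_init(3) by simp
    next
      case 4
      define k where "k = m - 3"
      have m: "m = k + 3" using 4 by (simp add: k_def)
      have "12 * of_nat (free_count m) =
          3 * (12 * of_nat (free_count (k + 2))) + 4 * (12 * of_nat (free_count k) :: complex)"
        unfolding m free_count_rec by simp
      also have "\<dots> = 3 * (f x (k + 2) + f y (k + 2) + f z (k + 2)) + 4 * (f x k + f y k + f z k)"
        using less[of "k + 2"] less[of k] m by simp
      also have "\<dots> = f x m + f y m + f z m"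
        unfolding m by (simp only: f_rec simp_thms) (simp add: algebra_simps)
      finally show ?thesis .
    qed
  qed
  also have "\<dots> = (\<Sum>\<alpha>\<in>{a, b, c}. (inverse \<alpha> + 1) * inverse \<alpha> ^ Suc m)"
    using dist by (simp add: f_def x_def y_def z_def add.assoc)
  finally show ?thesis unfolding roots by (simp add: mult.commute)
qed

theorem mainTheorem2:
  shows "Abs_fps (\<lambda>n. of_nat (pds3D n) :: rat) =
      (4 * fps_X ^ 5 + 2 * fps_X ^ 4 + 2 * fps_X ^ 2 - 3 * fps_X + 1) /
      ((1 - fps_X) * (1 - 3 * fps_X - 4 * fps_X ^ 3))
    \<and> pds3D 0 = 1 \<and> pds3D 1 = 1
    \<and> (\<forall>n\<ge>2. (of_nat (pds3D n) :: complex) =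
      1 / 12 * (\<Sum>\<alpha>\<in>{\<alpha>::complex. 1 - 3 * \<alpha> - 4 * \<alpha> ^ 3 = 0}.
                   (inverse \<alpha> + 1) * \<alpha> powi (- int n)) - 1)"
proof (intro conjI allI impI pds3D_gf pds3D_0 pds3D_1)
  fix n :: nat assume n: "2 \<le> n"
  have "(of_nat (pds3D n) :: complex) = of_nat (free_count (n - 1)) - 1"
    using pds3D_plus_1[OF n] by (metis add_diff_cancel_right' of_nat_1 of_nat_add)
  \<comment> \<open>The exponent \<open>Suc (n - 1)\<close> is the one in
    \<open>root_sum_formula\<close> for words of \<open>n - 1\<close> letters.\<close>
  moreover have "\<alpha> powi (- int n) = inverse \<alpha> ^ Suc (n - 1)" for \<alpha> :: complex
    using n by (simp add: power_int_minus power_inverse)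
  ultimately show "(of_nat (pds3D n) :: complex) =
      1 / 12 * (\<Sum>\<alpha>\<in>{\<alpha>::complex. 1 - 3 * \<alpha> - 4 * \<alpha> ^ 3 = 0}.
                   (inverse \<alpha> + 1) * \<alpha> powi (- int n)) - 1"
    by (simp only: root_sum_formula)
qed

end
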